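(* Let $d\in\{2,3\}$, let $k\ge1$ be an integer and let $\hat{\mathbf v}\in\hat{\mathbf V}^k(\hat E)$. Suppose that (i) $\int_{\hat e}\hat{\mathbf v}\cdot\hat{\mathbf n}_{\hat e}\,\hat p=0$ for all facets $\hat e\subset\partial\hat E$ and all $\hat p\in\mathcal Q^k(\hat e)$, and (ii) if $k\ge2$, $\int_{\hat E}\hat{\mathbf v}\cdot\hat{\mathbf p}=0$ for all $\hat{\mathbf p}$ in the space $$\big(\mathcal P^{k-2}(\hat x)\otimes\mathcal P^k(\hat y)\big)\times\big(\mathcal P^{k-2}(\hat y)\otimes\mathcal P^k(\hat x)\big)\quad\text{if }d=2,$$ $$\big(\mathcal P^{k-2}(\hat x)\otimes\mathcal Q^k(\hat y,\hat z)\big)\times\big(\mathcal P^{k-2}(\hat y)\otimes\mathcal Q^k(\hat x,\hat z)\big)\times\big(\mathcal P^{k-2}(\hat z)\otimes\mathcal Q^k(\hat x,\hat y)\big)\quad\text{if }d=3.$$ Then $\hat{\mathbf v}=0$.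
   Context: $\hat E=[-1,1]^d$ is the reference element, with coordinates $(\hat x,\hat y)$ if $d=2$ and $(\hat x,\hat y,\hat z)$ if $d=3$; facets are edges if $d=2$ and faces if $d=3$; $\hat{\mathbf n}_{\hat e}$ is the outward unit normal on $\hat e$. $\mathcal P^m$ denotes polynomials of total degree $\le m$ and $\mathcal Q^m$ polynomials of degree $\le m$ in each variable, in the indicated variables. The enhanced Raviart–Thomas space is $\hat{\mathbf V}^k(\hat E)=\hat{\mathbf V}^{k-1}_{RT}(\hat E)+\tilde{\mathcal B}^k(\hat E)$. Here $\hat{\mathbf V}^m_{RT}(\hat E)=(\mathcal Q^m+\hat x\mathcal Q^m)\times(\mathcal Q^m+\hat y\mathcal Q^m)\times(\mathcal Q^m+\hat z\mathcal Q^m)$ if $d=3$ (third component omitted if $d=2$), and $\tilde{\mathcal B}^k=\sum_{i=1}^d\tilde{\mathcal B}^k_i$, where (a term whose coefficient is zero is understood to be zero) for $d=2$ $$\tilde{\mathcal B}^k_1=\mathrm{span}\{((a_2+1)\hat x^{a_1}\hat y^{a_2},\,-a_1\hat x^{a_1-1}\hat y^{a_2+1})^T:\ 0\le a_1,a_2\le k,\ a_2=k\},$$ $$\tilde{\mathcal B}^k_2=\mathrm{span}\{(-b_2\hat x^{b_1+1}\hat y^{b_2-1},\,(b_1+1)\hat x^{b_1}\hat y^{b_2})^T:\ 0\le b_1,b_2\le k,\ b_1=k\},$$ and for $d=3$ $$\tilde{\mathcal B}^k_1=\mathrm{span}\{((a_2+a_3+2)\hat x^{a_1}\hat y^{a_2}\hat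 z^{a_3},\,-a_1\hat x^{a_1-1}\hat y^{a_2+1}\hat z^{a_3},\,-a_1\hat x^{a_1-1}\hat y^{a_2}\hat z^{a_3+1})^T:\ 0\le a_i\le k,\ a_2=k\text{ or }a_3=k\},$$ $$\tilde{\mathcal B}^k_2=\mathrm{span}\{(-b_2\hat x^{b_1+1}\hat y^{b_2-1}\hat z^{b_3},\,(b_1+b_3+2)\hat x^{b_1}\hat y^{b_2}\hat z^{b_3},\,-b_2\hat x^{b_1}\hat y^{b_2-1}\hat z^{b_3+1})^T:\ 0\le b_i\le k,\ b_1=k\text{ or }b_3=k\},$$ $$\tilde{\mathcal B}^k_3=\mathrm{span}\{(-c_3\hat x^{c_1+1}\hat y^{c_2}\hat z^{c_3-1},\,-c_3\hat x^{c_1}\hat y^{c_2+1}\hat z^{c_3-1},\,(c_1+c_2+2)\hat x^{c_1}\hat y^{c_2}\hat z^{c_3})^T:\ 0\le c_i\le k,\ c_1=k\text{ or }c_2=k\}.$$ *)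

theory Defs
  imports "HOL-Analysis.Analysis" "HOL-Library.Function_Algebras" "HOL-Library.Set_Algebras"
begin

text \<open>Functions form a real vector space pointwise, so that \<open>span\<close>, \<open>0\<close> and the sum \<open>A + B\<close>
  of two spaces of functions are those of the library. Polynomials and polynomial vector fields are
  represented by the functions they induce on the whole of \<open>\<real>\<^sup>d\<close>.\<close>

instantiation "fun" :: (type, real_vector) real_vector
begin

definition scaleR_fun :: "real \<Rightarrow> ('a \<Rightarrow> 'b) \<Rightarrow> 'a \<Rightarrow> 'b"
  where "scaleR_fun c f = (\<lambda>x. c *\<^sub>R f x)"

instance
  by standard (simp_all add: scaleR_fun_def fun_eq_iff scaleR_add_right scaleR_add_left)

end


definition ref_element :: "(real ^ 'n) set"
  where "ref_element = cbox (- 1) 1"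

text \<open>\<open>poly_P I m\<close> and \<open>poly_Q I m\<close> are the spaces \<open>P\<^sup>m\<close> and \<open>Q\<^sup>m\<close> in the variables \<open>x $ j\<close>, \<open>j \<in> I\<close>.\<close>

definition poly_P :: "'n set \<Rightarrow> nat \<Rightarrow> (real ^ 'n \<Rightarrow> real) set"
  where "poly_P I m = span {(\<lambda>x. \<Prod>j\<in>I. x $ j ^ a j) | a :: 'n \<Rightarrow> nat. (\<Sum>j\<in>I. a j) \<le> m}"

definition poly_Q :: "'n set \<Rightarrow> nat \<Rightarrow> (real ^ 'n \<Rightarrow> real) set"
  where "poly_Q I m = span {(\<lambda>x. \<Prod>j\<in>I. x $ j ^ a j) | a :: 'n \<Rightarrow> nat. \<forall>j\<in>I. a j \<le> m}"

definition tensor :: "('a \<Rightarrow> real) set \<Rightarrow> ('a \<Rightarrow> real) set \<Rightarrow> ('a \<Rightarrow> real) set"  (infixr "\<otimes>" 70)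
  where "A \<otimes> B = span {(\<lambda>x. p x * q x) | p q. p \<in> A \<and> q \<in> B}"


definition RT :: "nat \<Rightarrow> (real ^ 'n \<Rightarrow> real ^ 'n) set"
  where "RT m = {v. \<forall>i. (\<lambda>x. v x $ i) \<in> poly_Q UNIV m + (\<lambda>q x. x $ i * q x) ` poly_Q UNIV m}"

text \<open>In the bubble spaces an exponent \<open>n - 1\<close> is truncated for \<open>n = 0\<close>, but it then belongs to
  a term with coefficient \<open>n = 0\<close>.\<close>

definition bubble2_1 :: "nat \<Rightarrow> (real ^ 2 \<Rightarrow> real ^ 2) set"
  where "bubble2_1 k = span {(\<lambda>x. vector
      [(real a2 + 1) * x $ 1 ^ a1 * x $ 2 ^ a2,
       - real a1 * x $ 1 ^ (a1 - 1) * x $ 2 ^ (a2 + 1)]) | a1 a2.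
      a1 \<le> k \<and> a2 \<le> k \<and> a2 = k}"

definition bubble2_2 :: "nat \<Rightarrow> (real ^ 2 \<Rightarrow> real ^ 2) set"
  where "bubble2_2 k = span {(\<lambda>x. vector
      [- real b2 * x $ 1 ^ (b1 + 1) * x $ 2 ^ (b2 - 1),
       (real b1 + 1) * x $ 1 ^ b1 * x $ 2 ^ b2]) | b1 b2.
      b1 \<le> k \<and> b2 \<le> k \<and> b1 = k}"

definition bubble3_1 :: "nat \<Rightarrow> (real ^ 3 \<Rightarrow> real ^ 3) set"
  where "bubble3_1 k = span {(\<lambda>x. vector
      [(real a2 + real a3 + 2) * x $ 1 ^ a1 * x $ 2 ^ a2 * x $ 3 ^ a3,
       - real a1 * x $ 1 ^ (a1 - 1) * x $ 2 ^ (a2 + 1) * x $ 3 ^ a3,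
       - real a1 * x $ 1 ^ (a1 - 1) * x $ 2 ^ a2 * x $ 3 ^ (a3 + 1)]) | a1 a2 a3.
      a1 \<le> k \<and> a2 \<le> k \<and> a3 \<le> k \<and> (a2 = k \<or> a3 = k)}"

definition bubble3_2 :: "nat \<Rightarrow> (real ^ 3 \<Rightarrow> real ^ 3) set"
  where "bubble3_2 k = span {(\<lambda>x. vector
      [- real b2 * x $ 1 ^ (b1 + 1) * x $ 2 ^ (b2 - 1) * x $ 3 ^ b3,
       (real b1 + real b3 + 2) * x $ 1 ^ b1 * x $ 2 ^ b2 * x $ 3 ^ b3,
       - real b2 * x $ 1 ^ b1 * x $ 2 ^ (b2 - 1) * x $ 3 ^ (b3 + 1)]) | b1 b2 b3.
      b1 \<le> k \<and> b2 \<le> k \<and> b3 \<le> k \<and> (b1 = k \<or> b3 = k)}"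

definition bubble3_3 :: "nat \<Rightarrow> (real ^ 3 \<Rightarrow> real ^ 3) set"
  where "bubble3_3 k = span {(\<lambda>x. vector
      [- real c3 * x $ 1 ^ (c1 + 1) * x $ 2 ^ c2 * x $ 3 ^ (c3 - 1),
       - real c3 * x $ 1 ^ c1 * x $ 2 ^ (c2 + 1) * x $ 3 ^ (c3 - 1),
       (real c1 + real c2 + 2) * x $ 1 ^ c1 * x $ 2 ^ c2 * x $ 3 ^ c3]) | c1 c2 c3.
      c1 \<le> k \<and> c2 \<le> k \<and> c3 \<le> k \<and> (c1 = k \<or> c2 = k)}"

definition enhanced_RT2 :: "nat \<Rightarrow> (real ^ 2 \<Rightarrow> real ^ 2) set"
  where "enhanced_RT2 k = RT (k - 1) + (bubble2_1 k + bubble2_2 k)"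

definition enhanced_RT3 :: "nat \<Rightarrow> (real ^ 3 \<Rightarrow> real ^ 3) set"
  where "enhanced_RT3 k = RT (k - 1) + (bubble3_1 k + bubble3_2 k + bubble3_3 k)"


text \<open>The facets are the sets \<open>facet i s\<close> with \<open>s \<in> {-1, 1}\<close>. Surface integrals over them are
  taken in the isometric parametrizations \<open>edge_map\<close> and \<open>face_map\<close>.\<close>

definition facet :: "'n \<Rightarrow> real \<Rightarrow> (real ^ 'n) set"
  where "facet i s = {x \<in> ref_element. x $ i = s}"

definition outward_normal :: "'n \<Rightarrow> real \<Rightarrow> real ^ 'n"
  where "outward_normal i s = s *\<^sub>R axis i 1"

definition edge_map :: "2 \<Rightarrow> real \<Rightarrow> real \<Rightarrow> real ^ 2"
  where "edge_map i s t = (if i = 1 then vector [s, t] else vector [t, s])"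

definition face_map :: "3 \<Rightarrow> real \<Rightarrow> real ^ 2 \<Rightarrow> real ^ 3"
  where "face_map i s t =
    (if i = 1 then vector [s, t $ 1, t $ 2]
     else if i = 2 then vector [t $ 1, s, t $ 2]
     else vector [t $ 1, t $ 2, s])"

definition edge_integral :: "2 \<Rightarrow> real \<Rightarrow> (real ^ 2 \<Rightarrow> real) \<Rightarrow> real"
  where "edge_integral i s f = integral {-1..1} (\<lambda>t. f (edge_map i s t))"

definition face_integral :: "3 \<Rightarrow> real \<Rightarrow> (real ^ 3 \<Rightarrow> real) \<Rightarrow> real"
  where "face_integral i s f = integral ref_element (\<lambda>t. f (face_map i s t))"

lemma mem_ref_element: "x \<in> ref_element \<longleftrightarrow> (\<forall>i. - 1 \<le> x $ i \<and> x $ i \<le> 1)"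
  by (simp add: ref_element_def mem_box_cart)

lemma edge_map_image:
  assumes "s \<in> {-1, 1}"
  shows "edge_map i s ` {-1..1} = facet i s"
proof (intro equalityI subsetI)
  fix x assume "x \<in> edge_map i s ` {-1..1}"
  then show "x \<in> facet i s"
    using assms exhaust_2[of i]
    by (auto simp: edge_map_def facet_def mem_ref_element forall_2)
next
  fix x assume x: "x \<in> facet i s"
  show "x \<in> edge_map i s ` {-1..1}"
  proof (cases "i = 1")
    case True
    then show ?thesis using x
      by (intro image_eqI[where x = "x $ 2"])
        (auto simp: edge_map_def facet_def mem_ref_element forall_2 vec_eq_iff)
  next
    case False
    then have "i = 2" using exhaust_2 by blast
    then show ?thesis using x
      by (intro image_eqI[where x = "x $ 1"])
        (auto simp: edge_map_def facet_def mem_ref_element forall_2 vec_eq_iff)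
  qed
qed

lemma face_map_image:
  assumes "s \<in> {-1, 1}"
  shows "face_map i s ` ref_element = facet i s"
proof (intro equalityI subsetI)
  fix x assume "x \<in> face_map i s ` ref_element"
  then show "x \<in> facet i s"
    using assms exhaust_3[of i]
    by (auto simp: face_map_def facet_def mem_ref_element forall_2 forall_3)
next
  fix x assume x: "x \<in> facet i s"
  consider "i = 1" | "i = 2" | "i = 3" using exhaust_3 by blast
  then show "x \<in> face_map i s ` ref_element"
  proof cases
    case 1
    then show ?thesis using x
      by (intro image_eqI[where x = "vector [x $ 2, x $ 3]"])
        (auto simp: face_map_def facet_def mem_ref_element forall_2 forall_3 vec_eq_iff)
  next
    case 2
    then show ?thesis using x
      by (intro image_eqI[where x = "vector [x $ 1, x $ 3]"])
        (auto simp: face_map_def facet_def mem_ref_element forall_2 forall_3 vec_eq_iff)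
  next
    case 3
    then show ?thesis using x
      by (intro image_eqI[where x = "vector [x $ 1, x $ 2]"])
        (auto simp: face_map_def facet_def mem_ref_element forall_2 forall_3 vec_eq_iff)
  qed
qed


text \<open>Polynomials on a facet are polynomials in the variables other than the one fixed on it.\<close>

definition facet_Q :: "'n \<Rightarrow> nat \<Rightarrow> (real ^ 'n \<Rightarrow> real) set"
  where "facet_Q i k = poly_Q (- {i}) k"

definition interior_test2 :: "nat \<Rightarrow> (real ^ 2 \<Rightarrow> real ^ 2) set"
  where "interior_test2 k = {p.
      (\<lambda>x. p x $ 1) \<in> poly_P {1} (k - 2) \<otimes> poly_P {2} k \<and>
      (\<lambda>x. p x $ 2) \<in> poly_P {2} (k - 2) \<otimes> poly_P {1} k}"

definition interior_test3 :: "nat \<Rightarrow> (real ^ 3 \<Rightarrow> real ^ 3) set"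
  where "interior_test3 k = {p.
      (\<lambda>x. p x $ 1) \<in> poly_P {1} (k - 2) \<otimes> poly_Q {2, 3} k \<and>
      (\<lambda>x. p x $ 2) \<in> poly_P {2} (k - 2) \<otimes> poly_Q {1, 3} k \<and>
      (\<lambda>x. p x $ 3) \<in> poly_P {3} (k - 2) \<otimes> poly_Q {1, 2} k}"

end

theory Submission
  imports Defs
begin

text \<open>The proof does not depend on the dimension: it only uses how the monomial coefficients
  of the components of a field are tied together.

  Component \<open>i\<close> of a field of the enhanced space has degree at most \<open>k + 1\<close> in \<open>x $ i\<close> and at
  most \<open>k\<close> in the other variables. The facet and interior conditions test against all
  monomials of degree at most \<open>k\<close> in these other variables, so they split into conditions on
  the polynomials in \<open>x $ i\<close> alone which multiply them (\<open>slice_eq_0_if_moments_eq_0\<close>): such a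
  polynomial vanishes at \<open>-1\<close> and \<open>1\<close> and is orthogonal to all powers up to \<open>k - 2\<close>. If
  moreover its coefficient of degree \<open>k + 1\<close> is zero, it has the form \<open>(1 - t\<^sup>2) * h\<close> with \<open>h\<close>
  of degree at most \<open>k - 2\<close>, and then \<open>h = 0\<close> because it is orthogonal to itself for the
  weight \<open>1 - t\<^sup>2\<close> (\<open>coeffs_eq_0_if_endpoints_and_moments_eq_0\<close>). So it remains to show that
  the coefficients of degree \<open>k + 1\<close> in \<open>x $ i\<close> vanish in component \<open>i\<close>.

  Two linear properties of the enhanced space serve for this. The bubbles are divergence-free
  and the divergence of a Raviart--Thomas field of index \<open>k - 1\<close> has degree at most \<open>k - 1\<close> in
  each variable, so the divergence of the field contains no monomial with an exponent \<open>k\<close>. And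
  for a monomial \<open>a\<close> with \<open>a i = a j = k\<close>, the coefficient of \<open>x $ i\<close> times this monomial in
  component \<open>i\<close> equals that of \<open>x $ j\<close> times it in component \<open>j\<close>: it is zero for
  Raviart--Thomas fields, and for a bubble it can be nonzero only in the components other than
  the distinguished one, which have equal coefficients. Fields with these two properties are
  called admissible (\<open>RT_subset_admissible_fields\<close>, \<open>bubble_in_admissible_fields\<close>).

  A downward induction on the number of exponents of \<open>a\<close> that equal \<open>k\<close> then shows that all
  top coefficients vanish (\<open>admissible_eq_0\<close>): in the coefficient of \<open>a\<close> in the divergence,
  the terms from the variables with a smaller exponent vanish by the induction hypothesis, and
  the remaining ones are equal, so they are zero as well.\<close>

section \<open>Polynomials in one variable on the interval\<close>

definition moment :: "nat \<Rightarrow> real"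
  where "moment n = integral {-1..1} (\<lambda>t. t ^ n)"

lemma integral_poly_mult_power:
  fixes f :: "real poly"
  assumes "degree f \<le> N"
  shows "integral {-1..1} (\<lambda>t. poly f t * t ^ n) = (\<Sum>m\<le>N. coeff f m * moment (m + n))"
proof -
  have "poly f t = (\<Sum>m\<le>N. coeff f m * t ^ m)" for t
    unfolding poly_altdef
    by (rule sum.mono_neutral_left) (use assms in \<open>auto simp: coeff_eq_0\<close>)
  then have "integral {-1..1} (\<lambda>t. poly f t * t ^ n)
      = integral {-1..1} (\<lambda>t. \<Sum>m\<le>N. coeff f m * t ^ (m + n))"
    by (simp add: sum_distrib_right power_add mult.assoc)
  also have "\<dots> = (\<Sum>m\<le>N. integral {-1..1} (\<lambda>t. coeff f m * t ^ (m + n)))"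
    by (intro integral_sum integrable_continuous_real continuous_intros) auto
  also have "\<dots> = (\<Sum>m\<le>N. coeff f m * moment (m + n))"
    by (simp add: moment_def)
  finally show ?thesis .
qed

text \<open>The product \<open>f * w\<close> integrates to zero because \<open>w\<close> is a combination of the test powers, and a
  nonnegative polynomial with zero integral vanishes on the whole interval. This is the only place
  where positivity enters; the next two lemmas choose \<open>w\<close>.\<close>
lemma poly_mult_eq_0_if_orthogonal:
  fixes f w :: "real poly"
  assumes orth: "\<And>n. n \<le> degree w \<Longrightarrow> integral {-1..1} (\<lambda>t. poly f t * t ^ n) = 0"
    and nonneg: "\<And>t. -1 \<le> t \<Longrightarrow> t \<le> 1 \<Longrightarrow> 0 \<le> poly (f * w) t"
  shows "f * w = 0"
proof (rule ccontr)
  assume ne: "f * w \<noteq> 0"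
  have "integral {-1..1} (poly (f * w))
      = integral {-1..1} (\<lambda>t. \<Sum>n\<le>degree w. coeff w n * (poly f t * t ^ n))"
    by (intro arg_cong[where f = "integral {-1..1}"] ext)
      (simp add: poly_altdef[of w] sum_distrib_left mult.left_commute)
  also have "\<dots> = (\<Sum>n\<le>degree w. integral {-1..1} (\<lambda>t. coeff w n * (poly f t * t ^ n)))"
    by (intro integral_sum integrable_continuous_real continuous_intros) auto
  also have "\<dots> = 0"
    using orth by simp
  finally have "integral {-1..1} (poly (f * w)) = 0" .
  then have "\<forall>t\<in>{-1..1}. poly (f * w) t = 0"
    by (subst (asm) integral_eq_0_iff) (use nonneg in \<open>auto intro!: continuous_intros\<close>)
  then have "{-1..1::real} \<subseteq> {t. poly (f * w) t = 0}"
    by blast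
  with poly_roots_finite[OF ne] have "finite {-1..1::real}"
    by (rule finite_subset[rotated])
  then show False
    using infinite_Icc[of "-1::real" 1] by simp
qed

lemma poly_eq_0_if_moments_eq_0:
  fixes f :: "real poly"
  assumes "\<And>n. n \<le> degree f \<Longrightarrow> integral {-1..1} (\<lambda>t. poly f t * t ^ n) = 0"
  shows "f = 0"
  using poly_mult_eq_0_if_orthogonal[of f f] assms by simp

text \<open>The two zeros give \<open>f = (t\<^sup>2 - 1) * h\<close> with \<open>degree h \<le> k - 2\<close>, so \<open>w = - h\<close> has the degree
  required above, and \<open>- f * h = (1 - t\<^sup>2) * h\<^sup>2\<close> is nonnegative on the interval.\<close>
lemma poly_eq_0_if_endpoints_and_moments_eq_0:
  fixes f :: "real poly"
  assumes deg: "degree f \<le> k"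
    and ends: "poly f 1 = 0" "poly f (-1) = 0"
    and orth: "\<And>n. n + 2 \<le> k \<Longrightarrow> integral {-1..1} (\<lambda>t. poly f t * t ^ n) = 0"
  shows "f = 0"
proof (rule ccontr)
  assume "f \<noteq> 0"
  obtain g where g: "f = [:-1, 1:] * g"
    using ends(1) by (auto simp: poly_eq_0_iff_dvd)
  have "poly g (-1) = 0"
    using ends(2) by (simp add: g)
  then obtain h where h: "g = [:1, 1:] * h"
    by (auto simp: poly_eq_0_iff_dvd)
  have f: "f = [:-1, 1:] * ([:1, 1:] * h)"
    by (simp only: g h)
  have "h \<noteq> 0"
    using \<open>f \<noteq> 0\<close> by (auto simp: f)
  then have "[:1, 1:] * h \<noteq> 0"
    by (simp only: mult_eq_0_iff) simp
  then have "degree f = degree [:-1, 1::real:] + (degree [:1, 1::real:] + degree h)"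
    using degree_mult_eq[of "[:-1, 1:]" "[:1, 1:] * h"] degree_mult_eq[of "[:1, 1:]" h] \<open>h \<noteq> 0\<close>
    unfolding f by simp
  then have "degree f = degree h + 2"
    by simp
  then have dh: "degree h + 2 \<le> k"
    using deg by simp
  have "f * (- h) = 0"
  proof (rule poly_mult_eq_0_if_orthogonal)
    show "integral {-1..1} (\<lambda>t. poly f t * t ^ n) = 0" if "n \<le> degree (- h)" for n
      using orth[of n] that dh by simp
    fix t :: real
    assume "-1 \<le> t" "t \<le> 1"
    then have "0 \<le> (1 - t) * (1 + t) * (poly h t)\<^sup>2"
      by (intro mult_nonneg_nonneg) auto
    also have "\<dots> = poly (f * (- h)) t"
      by (simp add: f algebra_simps power2_eq_square)
    finally show "0 \<le> poly (f * (- h)) t" .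
  qed
  then show False
    using \<open>f \<noteq> 0\<close> \<open>h \<noteq> 0\<close> by simp
qed

lemma coeffs_eq_0_if_moments_eq_0:
  fixes c :: "nat \<Rightarrow> real"
  assumes "\<And>n. n \<le> N \<Longrightarrow> (\<Sum>m\<le>N. c m * moment (m + n)) = 0" and "m \<le> N"
  shows "c m = 0"
proof -
  define f where "f = (\<Sum>m\<le>N. monom (c m) m)"
  have cf: "coeff f m = (if m \<le> N then c m else 0)" for m
    by (simp add: f_def coeff_sum)
  have df: "degree f \<le> N"
    by (intro degree_le) (simp add: cf)
  have "f = 0"
    using df assms(1)
    by (intro poly_eq_0_if_moments_eq_0) (simp add: integral_poly_mult_power[OF df] cf)
  then show ?thesis
    using cf[of m] assms(2) by simp
qed

text \<open>Without the hypothesis on the top coefficient the solutions would, for \<open>k \<ge> 1\<close>, form a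
  one-dimensional space, spanned by \<open>1 - t\<^sup>2\<close> times the orthogonal polynomial of degree \<open>k - 1\<close> for
  this weight. So the top coefficients carry all the information that is left in a field with
  vanishing degrees of freedom.\<close>
lemma coeffs_eq_0_if_endpoints_and_moments_eq_0:
  fixes c :: "nat \<Rightarrow> real"
  assumes top: "c (Suc k) = 0"
    and ends: "\<And>s. s \<in> {-1, 1} \<Longrightarrow> (\<Sum>m\<le>Suc k. c m * s ^ m) = 0"
    and orth: "\<And>n. n + 2 \<le> k \<Longrightarrow> (\<Sum>m\<le>Suc k. c m * moment (m + n)) = 0"
    and m: "m \<le> Suc k"
  shows "c m = 0"
proof -
  define f where "f = (\<Sum>m\<le>Suc k. monom (c m) m)"
  have cf: "coeff f m = (if m \<le> Suc k then c m else 0)" for m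
    by (simp only: f_def coeff_sum coeff_monom) (simp add: sum.delta del: sum.atMost_Suc)
  have df: "degree f \<le> k"
    by (intro degree_le) (use top in \<open>auto simp: cf le_Suc_eq\<close>)
  then have df': "degree f \<le> Suc k"
    by simp
  have "f = 0"
  proof (rule poly_eq_0_if_endpoints_and_moments_eq_0[OF df])
    show "poly f 1 = 0" "poly f (-1) = 0"
      using ends[of 1] ends[of "-1"]
      by (simp_all only: f_def poly_sum poly_monom insert_iff simp_thms)
    show "integral {-1..1} (\<lambda>t. poly f t * t ^ n) = 0" if "n + 2 \<le> k" for n
      using orth[OF that] by (simp add: integral_poly_mult_power[OF df'] cf)
  qed
  then show ?thesis
    using cf[of m] m by simp
qed

section \<open>Tensor products of monomials\<close>

lemma sum_PiE_insert:
  assumes "i \<notin> J"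
  shows "(\<Sum>a\<in>Pi\<^sub>E (insert i J) A. g a) = (\<Sum>m\<in>A i. \<Sum>a\<in>Pi\<^sub>E J A. g (a(i := m)))"
  unfolding PiE_insert_eq
  by (subst sum.reindex[OF inj_combinator[OF assms]])
    (simp add: sum.cartesian_product case_prod_beta)

text \<open>The Gram matrix of the monomials on a box is a tensor product of the one-dimensional Gram
  matrices, so it is inverted in one variable at a time.\<close>
lemma tensor_coeffs_eq_0_if_moments_eq_0:
  fixes u :: "('i \<Rightarrow> nat) \<Rightarrow> real"
  assumes "finite J"
    and "\<And>b. (\<And>j. j \<in> J \<Longrightarrow> b j \<le> k) \<Longrightarrow>
      (\<Sum>a\<in>Pi\<^sub>E J (\<lambda>_. {..k}). u a * (\<Prod>j\<in>J. moment (a j + b j))) = 0"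
    and "a \<in> Pi\<^sub>E J (\<lambda>_. {..k})"
  shows "u a = 0"
  using assms
proof (induction J arbitrary: u a rule: finite_induct)
  case empty
  then show ?case
    by simp
next
  case (insert i J)
  obtain m a' where m: "m \<le> k" and a': "a' \<in> Pi\<^sub>E J (\<lambda>_. {..k})" and a: "a = a'(i := m)"
    using insert.prems(2) by (auto simp: PiE_insert_eq)
  \<comment> \<open>Integrating out the variable \<open>i\<close> against \<open>t ^ n\<close> leaves a family over \<open>J\<close>.\<close>
  define w where "w n e = (\<Sum>m\<le>k. u (e(i := m)) * moment (m + n))" for n e
  have w0: "w n a' = 0" if "n \<le> k" for n
  proof (rule insert.IH[OF _ a'])
    fix b :: "'i \<Rightarrow> nat"
    assume b: "\<And>j. j \<in> J \<Longrightarrow> b j \<le> k"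
    have other: "(\<Prod>j\<in>J. moment ((e(i := m)) j + (b(i := n)) j)) = (\<Prod>j\<in>J. moment (e j + b j))"
      for e m using insert.hyps(2) by (intro prod.cong) auto
    have "0 = (\<Sum>a\<in>Pi\<^sub>E (insert i J) (\<lambda>_. {..k}).
        u a * (\<Prod>j\<in>insert i J. moment (a j + (b(i := n)) j)))"
      by (rule insert.prems(1)[symmetric]) (use b that in auto)
    also have "\<dots> = (\<Sum>m\<le>k. \<Sum>e\<in>Pi\<^sub>E J (\<lambda>_. {..k}).
        u (e(i := m)) * (moment (m + n) * (\<Prod>j\<in>J. moment (e j + b j))))"
      by (subst sum_PiE_insert[OF insert.hyps(2)], subst prod.insert[OF insert.hyps])
        (simp only: other fun_upd_same)
    also have "\<dots> = (\<Sum>e\<in>Pi\<^sub>E J (\<lambda>_. {..k}). w n e * (\<Prod>j\<in>J. moment (e j + b j)))"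
      by (subst sum.swap) (simp add: w_def sum_distrib_right mult.assoc)
    finally show "(\<Sum>e\<in>Pi\<^sub>E J (\<lambda>_. {..k}). w n e * (\<Prod>j\<in>J. moment (e j + b j))) = 0" ..
  qed
  have "u (a'(i := m)) = 0"
    by (rule coeffs_eq_0_if_moments_eq_0[where c = "\<lambda>m. u (a'(i := m))" and N = k])
      (use w0 m in \<open>simp_all add: w_def del: fun_upd_apply\<close>)
  then show ?case
    by (simp only: a)
qed

text \<open>The monomials that can occur in component \<open>i\<close> of a field of the enhanced space: degree at most
  \<open>k + 1\<close> in the variable \<open>i\<close> and at most \<open>k\<close> in the others.\<close>
definition exponents :: "nat \<Rightarrow> 'n \<Rightarrow> ('n \<Rightarrow> nat) set"
  where "exponents k i = {a. \<forall>j. a j \<le> (if j = i then Suc k else k)}"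

lemma exponents_eq_PiE:
  "exponents k i = Pi\<^sub>E (insert i (- {i})) (\<lambda>j. {..if j = i then Suc k else k})"
proof -
  have "insert i (- {i}) = (UNIV :: 'a set)"
    by auto
  then show ?thesis
    by (auto simp: exponents_def PiE_def Pi_def)
qed

lemma finite_exponents [simp]: "finite (exponents k (i :: 'n :: finite))"
  unfolding exponents_eq_PiE by (intro finite_PiE) auto

text \<open>Testing against all monomials of degree at most \<open>k\<close> in the variables other than \<open>i\<close> separates the
  one-variable polynomials that multiply the monomials in these variables. The weights \<open>g\<close> are the
  values of the powers of \<open>x $ i\<close> under the remaining functional: \<open>g m = s ^ m\<close> on a facet and
  \<open>g m = moment (m + n)\<close> for an interior test.\<close>
lemma slice_eq_0_if_moments_eq_0:
  fixes c :: "('n :: finite \<Rightarrow> nat) \<Rightarrow> real" and g :: "nat \<Rightarrow> real"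
  assumes mom: "\<And>b. (\<And>j. j \<noteq> i \<Longrightarrow> b j \<le> k) \<Longrightarrow>
      (\<Sum>a\<in>exponents k i. c a * (g (a i) * (\<Prod>j\<in>- {i}. moment (a j + b j)))) = 0"
    and a: "\<And>j. j \<noteq> i \<Longrightarrow> a j \<le> k"
  shows "(\<Sum>m\<le>Suc k. c (a(i := m)) * g m) = 0"
proof -
  define u where "u e = (\<Sum>m\<le>Suc k. c (e(i := m)) * g m)" for e
  have "u (restrict a (- {i})) = 0"
  proof (rule tensor_coeffs_eq_0_if_moments_eq_0[where u = u and J = "- {i}" and k = k])
    fix b :: "'n \<Rightarrow> nat"
    assume b: "\<And>j. j \<in> - {i} \<Longrightarrow> b j \<le> k"
    have PiE: "Pi\<^sub>E (- {i}) (\<lambda>j. {..if j = i then Suc k else k}) = Pi\<^sub>E (- {i}) (\<lambda>_. {..k})"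
      by (intro PiE_cong) auto
    have other: "(\<Prod>j\<in>- {i}. moment ((e(i := m)) j + b j)) = (\<Prod>j\<in>- {i}. moment (e j + b j))"
      for e m by (intro prod.cong) auto
    have "0 = (\<Sum>a\<in>exponents k i. c a * (g (a i) * (\<Prod>j\<in>- {i}. moment (a j + b j))))"
      by (rule mom[symmetric]) (use b in auto)
    also have "\<dots> = (\<Sum>m\<le>Suc k. \<Sum>e\<in>Pi\<^sub>E (- {i}) (\<lambda>_. {..k}).
        c (e(i := m)) * (g m * (\<Prod>j\<in>- {i}. moment (e j + b j))))"
      unfolding exponents_eq_PiE
      by (subst sum_PiE_insert) (simp_all only: other PiE fun_upd_same if_True Compl_iff
          singleton_iff not_True_eq_False not_False_eq_True refl simp_thms)
    also have "\<dots> = (\<Sum>e\<in>Pi\<^sub>E (- {i}) (\<lambda>_. {..k}). u e * (\<Prod>j\<in>- {i}. moment (e j + b j)))"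
      by (subst sum.swap) (simp only: u_def sum_distrib_right mult.assoc)
    finally show "(\<Sum>e\<in>Pi\<^sub>E (- {i}) (\<lambda>_. {..k}). u e * (\<Prod>j\<in>- {i}. moment (e j + b j))) = 0"
      by simp
  qed (use a in auto)
  moreover have "(restrict a (- {i}))(i := m) = a(i := m)" for m
    by auto
  ultimately show ?thesis
    by (simp only: u_def)
qed

section \<open>Admissible coefficient families\<close>

definition raise :: "'n \<Rightarrow> ('n \<Rightarrow> nat) \<Rightarrow> 'n \<Rightarrow> nat"
  where "raise j a = a(j := Suc (a j))"

text \<open>Here \<open>c i a\<close> is the coefficient of the monomial \<open>a\<close> in component \<open>i\<close>. The second condition says
  that the divergence of the field contains no monomial having the exponent \<open>k\<close> in some variable. The
  third one ties together the top coefficients of different components, those of the degree \<open>k + 1\<close> in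
  the variable of the component.\<close>
definition admissible :: "nat \<Rightarrow> ('n :: finite \<Rightarrow> ('n \<Rightarrow> nat) \<Rightarrow> real) \<Rightarrow> bool"
  where "admissible k c \<longleftrightarrow>
    (\<forall>i a. c i a \<noteq> 0 \<longrightarrow> a \<in> exponents k i) \<and>
    (\<forall>a i. a i = k \<longrightarrow> (\<Sum>j\<in>UNIV. real (Suc (a j)) * c j (raise j a)) = 0) \<and>
    (\<forall>a i j. a i = k \<longrightarrow> a j = k \<longrightarrow> c i (raise i a) = c j (raise j a))"

lemma
  assumes "admissible k c"
  shows admissible_support: "a \<notin> exponents k i \<Longrightarrow> c i a = 0"
    and admissible_divergence: "a i = k \<Longrightarrow> (\<Sum>j\<in>UNIV. real (Suc (a j)) * c j (raise j a)) = 0"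
    and admissible_symmetric: "a i = k \<Longrightarrow> a j = k \<Longrightarrow> c i (raise i a) = c j (raise j a)"
proof -
  note conjs = assms[unfolded admissible_def]
  show "a \<notin> exponents k i \<Longrightarrow> c i a = 0"
    using conjs[THEN conjunct1, THEN spec, of i, THEN spec, of a] by (cases "c i a = 0") simp_all
  show "a i = k \<Longrightarrow> (\<Sum>j\<in>UNIV. real (Suc (a j)) * c j (raise j a)) = 0"
    by (rule conjs[THEN conjunct2, THEN conjunct1, THEN spec, of a, THEN spec, of i, THEN mp])
  show "a i = k \<Longrightarrow> a j = k \<Longrightarrow> c i (raise i a) = c j (raise j a)"
    by (rule conjs[THEN conjunct2, THEN conjunct2, THEN spec, of a, THEN spec, of i, THEN spec,
          of j, THEN mp, THEN mp])
qed

lemma admissibleI: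
  assumes "\<And>i a. a \<notin> exponents k i \<Longrightarrow> c i a = 0"
    and "\<And>a i. a i = k \<Longrightarrow> (\<Sum>j\<in>UNIV. real (Suc (a j)) * c j (raise j a)) = 0"
    and "\<And>a i j. a i = k \<Longrightarrow> a j = k \<Longrightarrow> c i (raise i a) = c j (raise j a)"
  shows "admissible k c"
  unfolding admissible_def
proof (intro conjI allI impI)
  show "a \<in> exponents k i" if "c i a \<noteq> 0" for i a
    using assms(1)[where a = a and i = i] that by (cases "a \<in> exponents k i") simp_all
  show "(\<Sum>j\<in>UNIV. real (Suc (a j)) * c j (raise j a)) = 0" if "a i = k" for a i
    by (rule assms(2)[where a = a and i = i, OF that])
  show "c i (raise i a) = c j (raise j a)" if "a i = k" "a j = k" for a i j
    by (rule assms(3)[where a = a and i = i and j = j, OF that])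
qed

text \<open>By the one-dimensional lemma it is enough to show that the top coefficients \<open>c i (raise i a)\<close> with
  \<open>a i = k\<close> vanish. Let \<open>S\<close> be the set of variables with exponent \<open>k\<close> in \<open>a\<close>, and proceed by downward
  induction on its size. For \<open>j\<close> outside \<open>S\<close>, the coefficient \<open>c j (raise j a)\<close> belongs to the same
  polynomial in \<open>x $ j\<close> as the top coefficient \<open>c j (raise j (a(j := k)))\<close>. This one is zero by the
  induction hypothesis, as \<open>a(j := k)\<close> has the larger set \<open>S \<union> {j}\<close>, and hence so is the polynomial. In the
  divergence condition at \<open>a\<close> only the terms with \<open>j\<close> in \<open>S\<close> survive. They are all equal by symmetry
  and carry the same factor \<open>k + 1\<close>, so each of them is zero.\<close>
lemma admissible_eq_0:
  fixes c :: "'n :: finite \<Rightarrow> ('n \<Rightarrow> nat) \<Rightarrow> real"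
  assumes adm: "admissible k c"
    and ends: "\<And>i s b. s \<in> {-1, 1} \<Longrightarrow> (\<And>j. j \<noteq> i \<Longrightarrow> b j \<le> k) \<Longrightarrow>
      (\<Sum>a\<in>exponents k i. c i a * (s ^ a i * (\<Prod>j\<in>- {i}. moment (a j + b j)))) = 0"
    and orth: "\<And>i b. b i + 2 \<le> k \<Longrightarrow> (\<And>j. j \<noteq> i \<Longrightarrow> b j \<le> k) \<Longrightarrow>
      (\<Sum>a\<in>exponents k i. c i a * (\<Prod>j\<in>UNIV. moment (a j + b j))) = 0"
  shows "c i a = 0"
proof -
  have lower: "c i a = 0"
    if top: "c i (a(i := Suc k)) = 0" and a: "a \<in> exponents k i" for i a
  proof -
    have le: "a j \<le> k" if "j \<noteq> i" for j
      using a that by (auto simp: exponents_def split: if_splits)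
    have "c i (a(i := a i)) = 0"
    proof (rule coeffs_eq_0_if_endpoints_and_moments_eq_0[of "\<lambda>m. c i (a(i := m))" k])
      show "c i (a(i := Suc k)) = 0"
        by (rule top)
      show "(\<Sum>m\<le>Suc k. c i (a(i := m)) * s ^ m) = 0" if "s \<in> {-1, 1}" for s
        by (rule slice_eq_0_if_moments_eq_0[where c = "c i" and g = "\<lambda>m. s ^ m", OF _ le])
          (rule ends[OF that])
      show "(\<Sum>m\<le>Suc k. c i (a(i := m)) * moment (m + n)) = 0" if n: "n + 2 \<le> k" for n
      proof (rule slice_eq_0_if_moments_eq_0[where c = "c i" and g = "\<lambda>m. moment (m + n)", OF _ le])
        fix b :: "'n \<Rightarrow> nat"
        assume b: "\<And>j. j \<noteq> i \<Longrightarrow> b j \<le> k"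
        have "(\<Sum>a\<in>exponents k i. c i a * (\<Prod>j\<in>UNIV. moment (a j + (b(i := n)) j))) = 0"
          by (rule orth) (use n b in auto)
        moreover have "(\<Prod>j\<in>UNIV. moment (a j + (b(i := n)) j))
            = moment (a i + n) * (\<Prod>j\<in>- {i}. moment (a j + b j))" for a
          by (subst prod.remove[of _ i]) (auto simp: Compl_eq_Diff_UNIV intro!: prod.cong)
        ultimately show "(\<Sum>a\<in>exponents k i.
            c i a * (moment (a i + n) * (\<Prod>j\<in>- {i}. moment (a j + b j)))) = 0"
          by simp
      qed
      show "a i \<le> Suc k"
        using a by (auto simp: exponents_def split: if_splits)
    qed
    then show ?thesis
      by simp
  qed
  have top: "c i (raise i a) = 0" if "\<And>j. a j \<le> k" "a i = k" for a i
    using that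
  proof (induction "card {j. a j \<noteq> k}" arbitrary: a i rule: less_induct)
    case less
    define S where "S = {j. a j = k}"
    have outside: "c j (raise j a) = 0" if "j \<notin> S" for j
    proof (rule lower)
      have aj: "a j \<noteq> k"
        using that by (simp add: S_def)
      \<comment> \<open>\<open>raise j a\<close> and \<open>raise j a'\<close> differ in the exponent \<open>j\<close> only, which is \<open>k + 1\<close> in the
        latter.\<close>
      define a' where "a' = a(j := k)"
      have "{l. a' l \<noteq> k} \<subset> {l. a l \<noteq> k}"
        using aj by (auto simp: a'_def)
      then have "card {l. a' l \<noteq> k} < card {l. a l \<noteq> k}"
        by (intro psubset_card_mono) auto
      then have "c j (raise j a') = 0"
        by (rule less.hyps) (use less.prems in \<open>auto simp: a'_def\<close>)
      moreover have "raise j a' = (raise j a)(j := Suc k)"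
        by (auto simp: raise_def a'_def)
      ultimately show "c j ((raise j a)(j := Suc k)) = 0"
        by simp
      show "raise j a \<in> exponents k j"
        using less.prems by (auto simp: exponents_def raise_def)
    qed
    have "0 = (\<Sum>j\<in>UNIV. real (Suc (a j)) * c j (raise j a))"
      by (rule admissible_divergence[where a = a and i = i, OF adm less.prems(2), symmetric])
    also have "\<dots> = (\<Sum>j\<in>S. real (Suc (a j)) * c j (raise j a))"
      by (rule sum.mono_neutral_right) (auto simp: outside)
    also have "\<dots> = (\<Sum>j\<in>S. real (Suc k) * c i (raise i a))"
    proof (intro sum.cong refl)
      fix j
      assume "j \<in> S"
      then have "a j = k"
        by (simp add: S_def)
      moreover from this have "c j (raise j a) = c i (raise i a)"
        by (rule admissible_symmetric[where a = a and i = j and j = i, OF adm _ less.prems(2)])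
      ultimately show "real (Suc (a j)) * c j (raise j a) = real (Suc k) * c i (raise i a)"
        by simp
    qed
    also have "\<dots> = real (card S) * (real (Suc k) * c i (raise i a))"
      by simp
    finally have *: "real (card S) * (real (Suc k) * c i (raise i a)) = 0" ..
    have "card S \<noteq> 0"
      using less.prems(2) by (auto simp: S_def)
    with * show ?case
      by (simp del: of_nat_Suc)
  qed
  show ?thesis
  proof (cases "a \<in> exponents k i")
    case True
    have "c i (raise i (a(i := k))) = 0"
      by (rule top) (use True in \<open>auto simp: exponents_def split: if_splits\<close>)
    then show ?thesis
      using lower[OF _ True] by (simp add: raise_def)
  qed (rule admissible_support[OF adm])
qed

section \<open>Integrals of monomials over the reference element\<close>

text \<open>The product formula for the measure \<open>\<Pi>\<^sub>M\<close>, transported to vectors along the bijection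
  between the indices and the standard basis.\<close>
lemma lborel_integral_prod_vec:
  fixes g :: "'n :: finite \<Rightarrow> real \<Rightarrow> real"
  assumes g: "\<And>j. integrable lborel (g j)"
  shows "(\<integral>x. (\<Prod>j\<in>UNIV. g j (x $ j)) \<partial>(lborel :: (real ^ 'n) measure)) = (\<Prod>j\<in>UNIV. \<integral>t. g j t \<partial>lborel)"
proof -
  interpret product_sigma_finite "\<lambda>_ :: real ^ 'n. lborel :: real measure"
    by standard
  define e where "e = (\<lambda>j :: 'n. axis j (1 :: real))"
  have inj: "inj e"
    by (auto simp: inj_def e_def axis_eq_axis)
  have Basis: "Basis = range e"
    by (auto simp: Basis_vec_def e_def)
  have coord: "(\<Sum>b\<in>Basis. f b *\<^sub>R b) $ j = f (e j)" for f :: "real ^ 'n \<Rightarrow> real" and j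
    unfolding Basis sum.reindex[OF inj] by (simp add: e_def axis_def if_distrib cong: if_cong)
  have [measurable]: "g j \<in> borel_measurable borel" for j
    using borel_measurable_integrable[OF g[of j]] by simp
  have "(\<integral>x. (\<Prod>j\<in>UNIV. g j (x $ j)) \<partial>(lborel :: (real ^ 'n) measure))
      = (\<integral>f. (\<Prod>j\<in>UNIV. g j ((\<Sum>b\<in>Basis. f b *\<^sub>R b) $ j)) \<partial>(\<Pi>\<^sub>M b\<in>(Basis :: (real ^ 'n) set). lborel))"
    by (subst lborel_eq, rule integral_distr) measurable
  also have "\<dots> = (\<integral>f. (\<Prod>b\<in>Basis. g (inv e b) (f b)) \<partial>(\<Pi>\<^sub>M b\<in>(Basis :: (real ^ 'n) set). lborel))"
    unfolding coord by (simp add: Basis prod.reindex[OF inj] inj)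
  also have "\<dots> = (\<Prod>b\<in>Basis. \<integral>t. g (inv e b) t \<partial>lborel)"
    by (rule product_integral_prod) (auto intro: g)
  also have "\<dots> = (\<Prod>j\<in>UNIV. \<integral>t. g j t \<partial>lborel)"
    by (simp add: Basis prod.reindex[OF inj] inj)
  finally show ?thesis .
qed

definition monomial :: "('n :: finite \<Rightarrow> nat) \<Rightarrow> real ^ 'n \<Rightarrow> real"
  where "monomial a x = (\<Prod>j\<in>UNIV. x $ j ^ a j)"

lemma monomial_integrable_on_ref_element: "monomial a integrable_on ref_element"
  unfolding ref_element_def monomial_def by (intro integrable_continuous continuous_intros)

lemma integral_monomial: "integral ref_element (monomial a) = (\<Prod>j\<in>UNIV. moment (a j))"
proof -
  let ?g = "\<lambda>j t. indicator {-1..1} t *\<^sub>R t ^ a j :: real"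
  have int: "set_integrable lborel {-1..1} (\<lambda>t. t ^ n :: real)" for n
    by (intro borel_integrable_atLeastAtMost') (intro continuous_intros)
  have ref: "indicator ref_element x *\<^sub>R monomial a x = (\<Prod>j\<in>UNIV. ?g j (x $ j))" for x
    by (auto simp: monomial_def mem_ref_element indicator_def intro!: prod.cong)
  have "set_integrable lborel ref_element (monomial a)"
    unfolding set_integrable_def ref_element_def monomial_def
    by (intro borel_integrable_compact) (auto intro!: continuous_intros)
  then have "integral ref_element (monomial a) = (LINT x:ref_element|lborel. monomial a x)"
    by (rule set_borel_integral_eq_integral(2)[symmetric])
  also have "\<dots> = (\<integral>x. (\<Prod>j\<in>UNIV. ?g j (x $ j)) \<partial>lborel)"
    by (simp only: set_lebesgue_integral_def ref)
  also have "\<dots> = (\<Prod>j\<in>UNIV. \<integral>t. ?g j t \<partial>lborel)"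
    by (rule lborel_integral_prod_vec) (use int in \<open>simp add: set_integrable_def\<close>)
  also have "\<dots> = (\<Prod>j\<in>UNIV. moment (a j))"
    unfolding moment_def
    by (intro prod.cong refl) (simp only: set_borel_integral_eq_integral(2)[OF int, symmetric]
        set_lebesgue_integral_def)
  finally show ?thesis .
qed

definition poly_field :: "nat \<Rightarrow> ('n :: finite \<Rightarrow> ('n \<Rightarrow> nat) \<Rightarrow> real) \<Rightarrow> real ^ 'n \<Rightarrow> real ^ 'n"
  where "poly_field k c x = (\<chi> i. \<Sum>a\<in>exponents k i. c i a * monomial a x)"

lemma monomial_split: "monomial a x = x $ i ^ a i * (\<Prod>j\<in>- {i}. x $ j ^ a j)"
  unfolding monomial_def by (subst prod.remove[of _ i]) (auto simp: Compl_eq_Diff_UNIV)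

lemma monomial_mult: "monomial a x * monomial b x = monomial (\<lambda>j. a j + b j) x"
  by (simp add: monomial_def power_add prod.distrib)

text \<open>The map \<open>\<Phi>\<close> stands for a parametrization of the facet \<open>x $ i = s\<close>; under it the
  integrals of monomials in the remaining variables are products of moments. The edges of the square
  and the faces of the cube are both of this kind.\<close>
lemma integral_field_flux:
  fixes \<Phi> :: "'b :: euclidean_space \<Rightarrow> real ^ 'n"
  assumes side: "\<And>t. \<Phi> t $ i = s"
    and int: "\<And>n. (\<lambda>t. \<Prod>j\<in>- {i}. \<Phi> t $ j ^ n j) integrable_on D"
    and mom: "\<And>n. integral D (\<lambda>t. \<Prod>j\<in>- {i}. \<Phi> t $ j ^ n j) = (\<Prod>j\<in>- {i}. moment (n j))"
  shows "integral D (\<lambda>t. poly_field k c (\<Phi> t) \<bullet> outward_normal i s * (\<Prod>j\<in>- {i}. \<Phi> t $ j ^ b j))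
    = s * (\<Sum>a\<in>exponents k i. c i a * (s ^ a i * (\<Prod>j\<in>- {i}. moment (a j + b j))))"
proof -
  have "poly_field k c (\<Phi> t) \<bullet> outward_normal i s * (\<Prod>j\<in>- {i}. \<Phi> t $ j ^ b j)
      = (\<Sum>a\<in>exponents k i. s * c i a * s ^ a i * (\<Prod>j\<in>- {i}. \<Phi> t $ j ^ (a j + b j)))" for t
    by (simp add: poly_field_def outward_normal_def inner_axis monomial_split[of _ _ i] side
        sum_distrib_left sum_distrib_right power_add prod.distrib mult_ac)
  then have "integral D (\<lambda>t. poly_field k c (\<Phi> t) \<bullet> outward_normal i s * (\<Prod>j\<in>- {i}. \<Phi> t $ j ^ b j))
      = integral D (\<lambda>t. \<Sum>a\<in>exponents k i. s * c i a * s ^ a i * (\<Prod>j\<in>- {i}. \<Phi> t $ j ^ (a j + b j)))"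
    by simp
  also have "\<dots> = (\<Sum>a\<in>exponents k i. integral D
      (\<lambda>t. s * c i a * s ^ a i * (\<Prod>j\<in>- {i}. \<Phi> t $ j ^ (a j + b j))))"
    by (intro integral_sum integrable_on_mult_right int) auto
  also have "\<dots> = (\<Sum>a\<in>exponents k i. s * c i a * s ^ a i * (\<Prod>j\<in>- {i}. moment (a j + b j)))"
    by (simp add: mom)
  finally show ?thesis
    by (simp add: sum_distrib_left mult_ac)
qed

lemma integral_field_axis_monomial:
  "integral ref_element (\<lambda>x. poly_field k c x \<bullet> axis i (monomial b x))
    = (\<Sum>a\<in>exponents k i. c i a * (\<Prod>j\<in>UNIV. moment (a j + b j)))"
proof -
  have "integral ref_element (\<lambda>x. poly_field k c x \<bullet> axis i (monomial b x))
      = integral ref_element (\<lambda>x. \<Sum>a\<in>exponents k i. c i a * monomial (\<lambda>j. a j + b j) x)"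
    by (simp add: poly_field_def inner_axis sum_distrib_right mult.assoc monomial_mult)
  also have "\<dots> = (\<Sum>a\<in>exponents k i. integral ref_element (\<lambda>x. c i a * monomial (\<lambda>j. a j + b j) x))"
    by (intro integral_sum integrable_on_mult_right monomial_integrable_on_ref_element) auto
  also have "\<dots> = (\<Sum>a\<in>exponents k i. c i a * (\<Prod>j\<in>UNIV. moment (a j + b j)))"
    by (simp add: integral_monomial)
  finally show ?thesis .
qed

section \<open>The space of admissible fields\<close>

definition admissible_fields :: "nat \<Rightarrow> (real ^ 'n \<Rightarrow> real ^ 'n) set"
  where "admissible_fields k = {poly_field k c | c. admissible k c}"

lemma subspace_admissible_fields: "subspace (admissible_fields k :: (real ^ 'n \<Rightarrow> real ^ 'n) set)"
  unfolding subspace_def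
proof (intro conjI allI ballI)
  have "(0 :: real ^ 'n \<Rightarrow> real ^ 'n) = poly_field k (\<lambda>_ _. 0)" "admissible k (\<lambda>(_ :: 'n) _. 0)"
    by (auto simp: poly_field_def fun_eq_iff vec_eq_iff intro: admissibleI)
  then show "(0 :: real ^ 'n \<Rightarrow> real ^ 'n) \<in> admissible_fields k"
    unfolding admissible_fields_def by blast
next
  fix v w :: "real ^ 'n \<Rightarrow> real ^ 'n"
  assume "v \<in> admissible_fields k" "w \<in> admissible_fields k"
  then obtain c d where c: "v = poly_field k c" "admissible k c" and d: "w = poly_field k d" "admissible k d"
    unfolding admissible_fields_def by blast
  have "v + w = poly_field k (\<lambda>i a. c i a + d i a)"
    by (auto simp: c d poly_field_def fun_eq_iff vec_eq_iff algebra_simps sum.distrib)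
  moreover have "admissible k (\<lambda>i a. c i a + d i a)"
  proof (rule admissibleI)
    show "c i a + d i a = 0" if "a \<notin> exponents k i" for i a
      using that by (simp add: admissible_support[OF c(2)] admissible_support[OF d(2)])
    show "(\<Sum>j\<in>UNIV. real (Suc (a j)) * (c j (raise j a) + d j (raise j a))) = 0"
      if "a i = k" for a i
      using admissible_divergence[where a = a and i = i, OF c(2) that]
        admissible_divergence[where a = a and i = i, OF d(2) that]
      unfolding distrib_left sum.distrib by simp
    show "c i (raise i a) + d i (raise i a) = c j (raise j a) + d j (raise j a)"
      if "a i = k" "a j = k" for a i j
      using admissible_symmetric[where a = a and i = i and j = j, OF c(2) that]
        admissible_symmetric[where a = a and i = i and j = j, OF d(2) that] by simp
  qed
  ultimately show "v + w \<in> admissible_fields k"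
    unfolding admissible_fields_def by blast
next
  fix r :: real and v :: "real ^ 'n \<Rightarrow> real ^ 'n"
  assume "v \<in> admissible_fields k"
  then obtain c where c: "v = poly_field k c" "admissible k c"
    unfolding admissible_fields_def by blast
  have "r *\<^sub>R v = poly_field k (\<lambda>i a. r * c i a)"
    by (auto simp: c poly_field_def fun_eq_iff vec_eq_iff scaleR_fun_def sum_distrib_left mult.assoc)
  moreover have "admissible k (\<lambda>i a. r * c i a)"
  proof (rule admissibleI)
    show "r * c i a = 0" if "a \<notin> exponents k i" for i a
      using that by (simp add: admissible_support[OF c(2)])
    show "(\<Sum>j\<in>UNIV. real (Suc (a j)) * (r * c j (raise j a))) = 0" if "a i = k" for a i
    proof -
      have "(\<Sum>j\<in>UNIV. real (Suc (a j)) * (r * c j (raise j a)))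
          = r * (\<Sum>j\<in>UNIV. real (Suc (a j)) * c j (raise j a))"
        by (simp only: sum_distrib_left mult.left_commute)
      then show ?thesis
        by (simp add: admissible_divergence[where a = a and i = i, OF c(2) that] del: of_nat_Suc)
    qed
    show "r * c i (raise i a) = r * c j (raise j a)" if "a i = k" "a j = k" for a i j
      using admissible_symmetric[where a = a and i = i and j = j, OF c(2) that] by simp
  qed
  ultimately show "r *\<^sub>R v \<in> admissible_fields k"
    unfolding admissible_fields_def by blast
qed

lemma span_monomialE:
  assumes "finite A" and "f \<in> span (monomial ` A)"
  obtains u where "\<And>a. a \<notin> A \<Longrightarrow> u a = 0" and "f = (\<lambda>x. \<Sum>a\<in>A. u a * monomial a x)"
proof -
  let ?S = "{f. \<exists>u. (\<forall>a. a \<notin> A \<longrightarrow> u a = 0) \<and> f = (\<lambda>x. \<Sum>a\<in>A. u a * monomial a x)}"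
  have "span (monomial ` A) \<subseteq> ?S"
  proof (rule span_minimal)
    show "monomial ` A \<subseteq> ?S"
    proof safe
      fix a assume "a \<in> A"
      then show "\<exists>u. (\<forall>a. a \<notin> A \<longrightarrow> u a = 0) \<and> monomial a = (\<lambda>x. \<Sum>a\<in>A. u a * monomial a x)"
        using assms(1)
        by (intro exI[of _ "\<lambda>e. if e = a then 1 else 0"] conjI ext)
          (auto simp: if_distrib[of "\<lambda>t. t * _"] sum.delta cong: if_cong)
    qed
    show "subspace ?S"
      unfolding subspace_def
    proof safe
      show "\<exists>u. (\<forall>a. a \<notin> A \<longrightarrow> u a = 0) \<and> 0 = (\<lambda>x. \<Sum>a\<in>A. u a * monomial a x)"
        by (intro exI[of _ "\<lambda>_. 0"]) (simp add: fun_eq_iff)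
    next
      fix u w :: "('a \<Rightarrow> nat) \<Rightarrow> real"
      assume "\<forall>a. a \<notin> A \<longrightarrow> u a = 0" "\<forall>a. a \<notin> A \<longrightarrow> w a = 0"
      then show "\<exists>z. (\<forall>a. a \<notin> A \<longrightarrow> z a = 0) \<and>
          (\<lambda>x. \<Sum>a\<in>A. u a * monomial a x) + (\<lambda>x. \<Sum>a\<in>A. w a * monomial a x)
          = (\<lambda>x. \<Sum>a\<in>A. z a * monomial a x)"
        by (intro exI[of _ "\<lambda>a. u a + w a"]) (simp add: fun_eq_iff sum.distrib distrib_right)
    next
      fix r :: real and u :: "('a \<Rightarrow> nat) \<Rightarrow> real"
      assume "\<forall>a. a \<notin> A \<longrightarrow> u a = 0"
      then show "\<exists>z. (\<forall>a. a \<notin> A \<longrightarrow> z a = 0) \<and>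
          r *\<^sub>R (\<lambda>x. \<Sum>a\<in>A. u a * monomial a x) = (\<lambda>x. \<Sum>a\<in>A. z a * monomial a x)"
        by (intro exI[of _ "\<lambda>a. r * u a"])
          (simp add: fun_eq_iff scaleR_fun_def sum_distrib_left mult.assoc)
    qed
  qed
  then show thesis
    using assms(2) that by blast
qed

lemma poly_Q_UNIV: "poly_Q UNIV m = span (monomial ` {a. \<forall>j. a j \<le> m})"
  unfolding poly_Q_def by (intro arg_cong[where f = span]) (auto simp: monomial_def fun_eq_iff)

text \<open>Multiplication by \<open>x $ i\<close> raises the degree in the variable \<open>i\<close> only.\<close>
lemma RT_component:
  fixes v :: "real ^ 'n \<Rightarrow> real ^ 'n"
  assumes "v \<in> RT m"
  shows "(\<lambda>x. v x $ i) \<in> span (monomial ` exponents m i)"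
proof -
  obtain p q where p: "p \<in> poly_Q UNIV m" and q: "q \<in> poly_Q UNIV m"
    and v: "(\<lambda>x. v x $ i) = p + (\<lambda>x. x $ i * q x)"
  proof -
    have "(\<lambda>x. v x $ i) \<in> poly_Q UNIV m + (\<lambda>q x. x $ i * q x) ` poly_Q UNIV m"
      using assms unfolding RT_def by blast
    then show thesis
      using that by (elim set_plus_elim) blast
  qed
  have "p \<in> span (monomial ` exponents m i)"
    using p unfolding poly_Q_UNIV
    by (rule subsetD[OF span_mono, rotated]) (auto simp: exponents_def intro!: le_SucI)
  moreover have "(\<lambda>x. x $ i * q x) \<in> span (monomial ` exponents m i)"
    using q unfolding poly_Q_UNIV
  proof (induction q rule: span_induct)
    case (step q)
    then obtain a where a: "\<And>j. a j \<le> m" and q: "q = monomial a"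
      by blast
    have other: "(\<Prod>j\<in>- {i}. x $ j ^ raise i a j) = (\<Prod>j\<in>- {i}. x $ j ^ a j)" for x :: "real ^ 'n"
      by (intro prod.cong) (auto simp: raise_def)
    have "(\<lambda>x. x $ i * q x) = monomial (raise i a)"
      unfolding q monomial_split[of _ _ i] other by (simp add: raise_def fun_eq_iff)
    then show ?case
      using a by (auto intro!: span_base simp: exponents_def raise_def)
  next
    case base
    have "(\<lambda>x. x $ i * (p + q) x) = (\<lambda>x. x $ i * p x) + (\<lambda>x. x $ i * q x)"
      "(\<lambda>x. x $ i * (r *\<^sub>R q) x) = r *\<^sub>R (\<lambda>x. x $ i * q x)"
      "(\<lambda>x. x $ i * (0 :: real ^ 'n \<Rightarrow> real) x) = 0"
      for p q :: "real ^ 'n \<Rightarrow> real" and r :: real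
      by (auto simp: fun_eq_iff scaleR_fun_def algebra_simps)
    then show ?case
      by (auto simp: subspace_def intro: span_zero span_add span_scale)
  qed
  ultimately show ?thesis
    unfolding v by (rule span_add)
qed

text \<open>If the monomial \<open>raise j a\<close> occurs in component \<open>j\<close> of a Raviart--Thomas field of index \<open>k - 1\<close>, then
  all exponents of \<open>a\<close> are at most \<open>k - 1\<close>. The divergence and symmetry conditions only concern \<open>a\<close> with
  some exponent \<open>k\<close>, so all coefficients in them are zero.\<close>
lemma RT_subset_admissible_fields:
  assumes "k \<ge> 1"
  shows "RT (k - 1) \<subseteq> (admissible_fields k :: (real ^ 'n \<Rightarrow> real ^ 'n) set)"
proof
  fix v :: "real ^ 'n \<Rightarrow> real ^ 'n"
  assume v: "v \<in> RT (k - 1)"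
  have "\<forall>i. \<exists>u. (\<forall>a. a \<notin> exponents (k - 1) i \<longrightarrow> u a = 0) \<and>
      (\<lambda>x. v x $ i) = (\<lambda>x. \<Sum>a\<in>exponents (k - 1) i. u a * monomial a x)"
    by (rule allI, rule span_monomialE[OF finite_exponents RT_component[OF v]]) blast
  from choice[OF this] obtain c where c: "\<And>i a. a \<notin> exponents (k - 1) i \<Longrightarrow> c i a = 0"
    and vc: "\<And>i. (\<lambda>x. v x $ i) = (\<lambda>x. \<Sum>a\<in>exponents (k - 1) i. c i a * monomial a x)"
    by blast
  have sub: "exponents (k - 1) i \<subseteq> exponents k i" for i :: 'n
    by (auto simp: exponents_def intro: order_trans)
  have vanish: "c j (raise j a) = 0" if "a i = k" for i j a
  proof (rule c)
    have "\<not> raise j a i \<le> (if i = j then Suc (k - 1) else k - 1)"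
      using that assms by (auto simp: raise_def)
    then show "raise j a \<notin> exponents (k - 1) j"
      unfolding exponents_def by blast
  qed
  have "v = poly_field k c"
  proof (intro ext vec_eq_iff[THEN iffD2] allI)
    fix x i
    have "v x $ i = (\<Sum>a\<in>exponents (k - 1) i. c i a * monomial a x)"
      using vc by (simp add: fun_eq_iff)
    also have "\<dots> = (\<Sum>a\<in>exponents k i. c i a * monomial a x)"
      by (rule sum.mono_neutral_left) (use sub c in auto)
    finally show "v x $ i = poly_field k c x $ i"
      by (simp add: poly_field_def)
  qed
  moreover have "admissible k c"
    by (rule admissibleI) (use c sub vanish in \<open>auto intro!: sum.neutral\<close>)
  ultimately show "v \<in> admissible_fields k"
    unfolding admissible_fields_def by blast
qed

text \<open>The generators of the bubble spaces in any dimension. If \<open>a i = 0\<close>, the truncated exponent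
  belongs to a vanishing coefficient.\<close>
definition bubble :: "'n :: finite \<Rightarrow> ('n \<Rightarrow> nat) \<Rightarrow> real ^ 'n \<Rightarrow> real ^ 'n"
  where "bubble i a x = (\<chi> j.
    if j = i then (\<Sum>l\<in>- {i}. real (Suc (a l))) * monomial a x
    else - real (a i) * monomial (raise j (a(i := a i - 1))) x)"

lemma raise_inject [simp]: "raise j a = raise j b \<longleftrightarrow> a = b"
  unfolding raise_def fun_eq_iff by (metis fun_upd_apply nat.inject)

text \<open>If \<open>a i = 0\<close>, the only monomial is \<open>a\<close> in component \<open>i\<close>, which is not of the form \<open>raise i e\<close>, so the
  conditions are trivial. Otherwise let \<open>a'\<close> be \<open>a\<close> with its \<open>i\<close>th exponent lowered by one. The
  monomial in each component \<open>j\<close> is then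
  \<open>raise j a'\<close>, so only the exponent \<open>a'\<close> can occur in the divergence, and there the terms cancel. For
  the symmetry condition, \<open>a' i < k\<close> excludes the index \<open>i\<close>, and the other components all have the
  same coefficient \<open>- a i\<close>.\<close>
lemma bubble_in_admissible_fields:
  fixes a :: "'n :: finite \<Rightarrow> nat"
  assumes a: "\<And>j. a j \<le> k"
  shows "bubble i a \<in> admissible_fields k"
proof -
  define W where "W = (\<Sum>l\<in>- {i}. real (Suc (a l)))"
  define a' where "a' = a(i := a i - 1)"
  define c where "c j e = (if j = i then if e = a then W else 0
      else if e = raise j a' then - real (a i) else 0)" for j e
  have supp: "e \<in> exponents k j" if "c j e \<noteq> 0" for j and e :: "'n \<Rightarrow> nat"
  proof (cases "j = i")
    case True
    then have "e = a"
      using that by (auto simp: c_def split: if_splits)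
    then show ?thesis
      using a by (auto simp: exponents_def intro: le_SucI)
  next
    case False
    then have "e = raise j a'"
      using that by (auto simp: c_def split: if_splits)
    then show ?thesis
      using a False by (auto simp: exponents_def raise_def a'_def intro: le_trans[OF diff_le_self])
  qed
  have "bubble i a x $ j = poly_field k c x $ j" for x j
  proof (cases "j = i")
    case True
    have "a \<in> exponents k i"
      using a by (auto simp: exponents_def intro: le_SucI)
    then show ?thesis
      using True by (simp add: bubble_def poly_field_def c_def W_def if_distrib[of "\<lambda>t. t * _"] sum.delta
          cong: if_cong)
  next
    case False
    have "raise j a' \<in> exponents k j"
      using a False by (auto simp: exponents_def raise_def a'_def intro: le_trans[OF diff_le_self])
    then show ?thesis
      using False by (simp add: bubble_def poly_field_def c_def a'_def if_distrib[of "\<lambda>t. t * _"] sum.delta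
          cong: if_cong)
  qed
  then have "bubble i a = poly_field k c"
    by (intro ext vec_eq_iff[THEN iffD2] allI)
  moreover have "admissible k c"
  proof -
    have craise: "c j (raise j e) = (if e = a' \<and> a i > 0 then if j = i then W else - real (a i) else 0)"
      for j e
    proof (cases "j = i")
      case True
      have "raise i e = a \<longleftrightarrow> e = a' \<and> a i > 0"
        by (auto simp: raise_def a'_def)
      then show ?thesis
        using True by (simp add: c_def)
    qed (auto simp: c_def)
    have ai: "a' i < k" if "a i > 0"
      using a[of i] that by (simp add: a'_def)
    have "(\<Sum>j\<in>UNIV. real (Suc (e j)) * c j (raise j e)) = 0" for e
    proof (cases "e = a' \<and> a i > 0")
      case True
      have "(\<Sum>j\<in>UNIV. real (Suc (e j)) * c j (raise j e))
          = real (Suc (e i)) * W + (\<Sum>j\<in>- {i}. real (Suc (e j)) * - real (a i))"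
        using True by (subst sum.remove[of _ i]) (auto simp: craise Compl_eq_Diff_UNIV intro!: sum.cong)
      also have "(\<Sum>j\<in>- {i}. real (Suc (e j)) * - real (a i)) = (\<Sum>j\<in>- {i}. real (Suc (a j)) * - real (a i))"
        using True by (intro sum.cong) (auto simp: a'_def)
      also have "real (Suc (e i)) * W + \<dots> = 0"
        using True by (simp add: W_def a'_def sum_distrib_left sum_negf mult.commute del: of_nat_Suc)
      finally show ?thesis .
    qed (auto simp: craise)
    moreover have "c p (raise p e) = c q (raise q e)" if "e p = k" "e q = k" for e p q
      using that ai by (auto simp: craise)
    ultimately show ?thesis
      using supp by (intro admissibleI) blast+
  qed
  ultimately show ?thesis
    unfolding admissible_fields_def by blast
qed

section \<open>The enhanced spaces on the square and the cube\<close>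

lemma Compl_2: "- {1 :: 2} = {2}" "- {2 :: 2} = {1}"
  by (simp_all only: Compl_eq_Diff_UNIV UNIV_2) auto

lemma Compl_3: "- {1 :: 3} = {2, 3}" "- {2 :: 3} = {1, 3}" "- {3 :: 3} = {1, 2}"
  by (simp_all only: Compl_eq_Diff_UNIV UNIV_3) auto

lemma monomial_2: "monomial a x = x $ 1 ^ a 1 * x $ 2 ^ a 2" for a :: "2 \<Rightarrow> nat"
  unfolding monomial_split[of a x 1] Compl_2 by simp

lemma monomial_3: "monomial a x = x $ 1 ^ a 1 * x $ 2 ^ a 2 * x $ 3 ^ a 3" for a :: "3 \<Rightarrow> nat"
  unfolding monomial_split[of a x 1] Compl_3 by simp

lemma set_plus_subset_admissible_fields:
  assumes "A \<subseteq> admissible_fields k" and "B \<subseteq> admissible_fields k"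
  shows "A + B \<subseteq> admissible_fields k"
proof
  fix v assume "v \<in> A + B"
  then obtain a b where "v = a + b" "a \<in> A" "b \<in> B"
    by (rule set_plus_elim)
  moreover from this have "a \<in> admissible_fields k" "b \<in> admissible_fields k"
    using assms by blast+
  ultimately show "v \<in> admissible_fields k"
    by (simp only: subspace_add[OF subspace_admissible_fields])
qed

lemma enhanced_RT2_subset_admissible_fields:
  assumes "k \<ge> 1"
  shows "enhanced_RT2 k \<subseteq> admissible_fields k"
proof -
  have bubble: "bubble i (\<lambda>j. if j = 1 then p else q) \<in> admissible_fields k"
    if "p \<le> k" "q \<le> k" for p q and i :: 2
    by (rule bubble_in_admissible_fields) (simp add: that)
  have generator_1: "(\<lambda>x. vector
      [(real a2 + 1) * x $ 1 ^ a1 * x $ 2 ^ a2,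
       - real a1 * x $ 1 ^ (a1 - 1) * x $ 2 ^ (a2 + 1)])
    = bubble 1 (\<lambda>j :: 2. if j = 1 then a1 else a2)" for a1 a2
    by (rule ext) (simp add: vec_eq_iff forall_2 bubble_def raise_def monomial_2 Compl_2)
  have subset_1: "bubble2_1 k \<subseteq> admissible_fields k"
    unfolding bubble2_1_def generator_1
    by (rule span_minimal[OF _ subspace_admissible_fields]) (use bubble in blast)
  have generator_2: "(\<lambda>x. vector
      [- real b2 * x $ 1 ^ (b1 + 1) * x $ 2 ^ (b2 - 1),
       (real b1 + 1) * x $ 1 ^ b1 * x $ 2 ^ b2])
    = bubble 2 (\<lambda>j :: 2. if j = 1 then b1 else b2)" for b1 b2
    by (rule ext) (simp add: vec_eq_iff forall_2 bubble_def raise_def monomial_2 Compl_2)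
  have subset_2: "bubble2_2 k \<subseteq> admissible_fields k"
    unfolding bubble2_2_def generator_2
    by (rule span_minimal[OF _ subspace_admissible_fields]) (use bubble in blast)
  show ?thesis
    unfolding enhanced_RT2_def
    by (intro set_plus_subset_admissible_fields RT_subset_admissible_fields assms subset_1 subset_2)
qed

lemma enhanced_RT3_subset_admissible_fields:
  assumes "k \<ge> 1"
  shows "enhanced_RT3 k \<subseteq> admissible_fields k"
proof -
  have bubble: "bubble i (\<lambda>j. if j = 1 then p else if j = 2 then q else r) \<in> admissible_fields k"
    if "p \<le> k" "q \<le> k" "r \<le> k" for p q r and i :: 3
    by (rule bubble_in_admissible_fields) (simp add: that)
  have generator_1: "(\<lambda>x. vector
      [(real a2 + real a3 + 2) * x $ 1 ^ a1 * x $ 2 ^ a2 * x $ 3 ^ a3,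
       - real a1 * x $ 1 ^ (a1 - 1) * x $ 2 ^ (a2 + 1) * x $ 3 ^ a3,
       - real a1 * x $ 1 ^ (a1 - 1) * x $ 2 ^ a2 * x $ 3 ^ (a3 + 1)])
    = bubble 1 (\<lambda>j :: 3. if j = 1 then a1 else if j = 2 then a2 else a3)" for a1 a2 a3
    by (rule ext) (simp add: vec_eq_iff forall_3 bubble_def raise_def monomial_3 Compl_3)
  have subset_1: "bubble3_1 k \<subseteq> admissible_fields k"
    unfolding bubble3_1_def generator_1
    by (rule span_minimal[OF _ subspace_admissible_fields]) (use bubble in blast)
  have generator_2: "(\<lambda>x. vector
      [- real b2 * x $ 1 ^ (b1 + 1) * x $ 2 ^ (b2 - 1) * x $ 3 ^ b3,
       (real b1 + real b3 + 2) * x $ 1 ^ b1 * x $ 2 ^ b2 * x $ 3 ^ b3,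
       - real b2 * x $ 1 ^ b1 * x $ 2 ^ (b2 - 1) * x $ 3 ^ (b3 + 1)])
    = bubble 2 (\<lambda>j :: 3. if j = 1 then b1 else if j = 2 then b2 else b3)" for b1 b2 b3
    by (rule ext) (simp add: vec_eq_iff forall_3 bubble_def raise_def monomial_3 Compl_3)
  have subset_2: "bubble3_2 k \<subseteq> admissible_fields k"
    unfolding bubble3_2_def generator_2
    by (rule span_minimal[OF _ subspace_admissible_fields]) (use bubble in blast)
  have generator_3: "(\<lambda>x. vector
      [- real c3 * x $ 1 ^ (c1 + 1) * x $ 2 ^ c2 * x $ 3 ^ (c3 - 1),
       - real c3 * x $ 1 ^ c1 * x $ 2 ^ (c2 + 1) * x $ 3 ^ (c3 - 1),
       (real c1 + real c2 + 2) * x $ 1 ^ c1 * x $ 2 ^ c2 * x $ 3 ^ c3])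
    = bubble 3 (\<lambda>j :: 3. if j = 1 then c1 else if j = 2 then c2 else c3)" for c1 c2 c3
    by (rule ext) (simp add: vec_eq_iff forall_3 bubble_def raise_def monomial_3 Compl_3)
  have subset_3: "bubble3_3 k \<subseteq> admissible_fields k"
    unfolding bubble3_3_def generator_3
    by (rule span_minimal[OF _ subspace_admissible_fields]) (use bubble in blast)
  show ?thesis
    unfolding enhanced_RT3_def
    by (intro set_plus_subset_admissible_fields RT_subset_admissible_fields assms
        subset_1 subset_2 subset_3)
qed

section \<open>Facet and interior tests\<close>

lemma edge_integral_field_flux:
  "edge_integral i s (\<lambda>x. poly_field k c x \<bullet> outward_normal i s * (\<Prod>j\<in>- {i}. x $ j ^ b j))
    = s * (\<Sum>a\<in>exponents k i. c i a * (s ^ a i * (\<Prod>j\<in>- {i}. moment (a j + b j))))"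
  unfolding edge_integral_def
proof (rule integral_field_flux)
  consider "i = 1" | "i = 2"
    using exhaust_2 by blast
  note cases = this
  show "edge_map i s t $ i = s" for t
    by (cases rule: cases) (simp_all add: edge_map_def)
  show "(\<lambda>t. \<Prod>j\<in>- {i}. edge_map i s t $ j ^ n j) integrable_on {-1..1}" for n
    by (cases rule: cases) (auto simp: edge_map_def Compl_2 intro!: integrable_continuous_real continuous_intros)
  show "integral {-1..1} (\<lambda>t. \<Prod>j\<in>- {i}. edge_map i s t $ j ^ n j) = (\<Prod>j\<in>- {i}. moment (n j))" for n
    by (cases rule: cases) (simp_all add: edge_map_def Compl_2 moment_def)
qed

lemma face_integral_field_flux:
  "face_integral i s (\<lambda>x. poly_field k c x \<bullet> outward_normal i s * (\<Prod>j\<in>- {i}. x $ j ^ b j))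
    = s * (\<Sum>a\<in>exponents k i. c i a * (s ^ a i * (\<Prod>j\<in>- {i}. moment (a j + b j))))"
  unfolding face_integral_def
proof (rule integral_field_flux)
  consider "i = 1" | "i = 2" | "i = 3"
    using exhaust_3 by blast
  note cases = this
  \<comment> \<open>The exponents of the monomial in the two parameters of the face.\<close>
  define m where "m n = (\<lambda>j :: 2. if j = 1 then if i = 1 then n 2 else n 1
      else if i = 3 then n 2 else n 3)" for n :: "3 \<Rightarrow> nat"
  show "face_map i s t $ i = s" for t
    by (cases rule: cases) (simp_all add: face_map_def)
  have face: "(\<lambda>t. \<Prod>j\<in>- {i}. face_map i s t $ j ^ n j) = monomial (m n)" for n
    by (cases rule: cases) (simp_all add: face_map_def m_def monomial_2 Compl_3 fun_eq_iff)
  show "(\<lambda>t. \<Prod>j\<in>- {i}. face_map i s t $ j ^ n j) integrable_on ref_element" for n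
    unfolding face by (rule monomial_integrable_on_ref_element)
  show "integral ref_element (\<lambda>t. \<Prod>j\<in>- {i}. face_map i s t $ j ^ n j) = (\<Prod>j\<in>- {i}. moment (n j))"
    for n
    unfolding face integral_monomial
    by (cases rule: cases) (simp_all add: m_def UNIV_2 Compl_3)
qed

lemma facet_monomial_in_facet_Q:
  assumes "\<And>j. j \<noteq> i \<Longrightarrow> b j \<le> k"
  shows "(\<lambda>x. \<Prod>j\<in>- {i}. x $ j ^ b j) \<in> facet_Q i k"
  unfolding facet_Q_def poly_Q_def by (rule span_base) (use assms in auto)

lemma prod_power_in_poly_P:
  assumes "(\<Sum>j\<in>I. b j) \<le> m"
  shows "(\<lambda>x. \<Prod>j\<in>I. x $ j ^ b j) \<in> poly_P I m"
  unfolding poly_P_def by (rule span_base) (use assms in auto)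

lemma prod_power_in_poly_Q:
  assumes "\<And>j. j \<in> I \<Longrightarrow> b j \<le> m"
  shows "(\<lambda>x. \<Prod>j\<in>I. x $ j ^ b j) \<in> poly_Q I m"
  unfolding poly_Q_def by (rule span_base) (use assms in auto)

lemma monomial_in_tensor:
  assumes "(\<lambda>x. \<Prod>j\<in>{i}. x $ j ^ b j) \<in> A" and "(\<lambda>x. \<Prod>j\<in>- {i}. x $ j ^ b j) \<in> B"
  shows "monomial b \<in> A \<otimes> B"
  unfolding tensor_def
proof (rule span_base, rule CollectI, intro exI conjI)
  show "monomial b = (\<lambda>x. (\<Prod>j\<in>{i}. x $ j ^ b j) * (\<Prod>j\<in>- {i}. x $ j ^ b j))"
    by (simp add: fun_eq_iff monomial_split[of _ _ i])
qed (fact assms)+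

lemma zero_in_tensor: "(\<lambda>x. 0) \<in> A \<otimes> B"
  unfolding tensor_def zero_fun_def[symmetric] by (rule span_zero)

lemma axis_monomial_in_interior_test2:
  assumes "b i + 2 \<le> k" and "\<And>j. j \<noteq> i \<Longrightarrow> b j \<le> k"
  shows "(\<lambda>x. axis i (monomial b x)) \<in> interior_test2 k"
proof -
  have "monomial b \<in> poly_P {i} (k - 2) \<otimes> poly_P (- {i}) k"
    by (rule monomial_in_tensor[where i = i]; rule prod_power_in_poly_P)
      (use assms exhaust_2[of i] in \<open>auto simp: Compl_2\<close>)
  then show ?thesis
    using exhaust_2[of i] by (auto simp: interior_test2_def axis_def Compl_2 zero_in_tensor)
qed

lemma axis_monomial_in_interior_test3:
  assumes "b i + 2 \<le> k" and "\<And>j. j \<noteq> i \<Longrightarrow> b j \<le> k"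
  shows "(\<lambda>x. axis i (monomial b x)) \<in> interior_test3 k"
proof -
  have "monomial b \<in> poly_P {i} (k - 2) \<otimes> poly_Q (- {i}) k"
    by (rule monomial_in_tensor[where i = i], rule prod_power_in_poly_P, use assms in simp)
      (rule prod_power_in_poly_Q, use assms in auto)
  then show ?thesis
    using exhaust_3[of i] by (auto simp: interior_test3_def axis_def Compl_3 zero_in_tensor)
qed

text \<open>The functional \<open>I i s\<close> stands for integration over the facet, and \<open>T\<close> for the space of interior test
  fields. Abstracting from them lets the square and the cube share the final argument, which tests
  with facet monomials and with interior fields that have a single monomial component.\<close>
lemma admissible_field_eq_0:
  fixes v :: "real ^ 'n \<Rightarrow> real ^ 'n"
  assumes v: "v \<in> admissible_fields k"
    and flux: "\<And>i s p. s \<in> {-1, 1} \<Longrightarrow> p \<in> facet_Q i k \<Longrightarrow>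
      I i s (\<lambda>x. v x \<bullet> outward_normal i s * p x) = 0"
    and I: "\<And>i s c b. s \<in> {-1, 1} \<Longrightarrow>
      I i s (\<lambda>x. poly_field k c x \<bullet> outward_normal i s * (\<Prod>j\<in>- {i}. x $ j ^ b j))
      = s * (\<Sum>a\<in>exponents k i. c i a * (s ^ a i * (\<Prod>j\<in>- {i}. moment (a j + b j))))"
    and interior: "\<And>p. k \<ge> 2 \<Longrightarrow> p \<in> T \<Longrightarrow> integral ref_element (\<lambda>x. v x \<bullet> p x) = 0"
    and T: "\<And>i b. b i + 2 \<le> k \<Longrightarrow> (\<And>j. j \<noteq> i \<Longrightarrow> b j \<le> k) \<Longrightarrow> (\<lambda>x. axis i (monomial b x)) \<in> T"
  shows "v = 0"
proof -
  obtain c where c: "admissible k c" and vc: "v = poly_field k c"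
    using v unfolding admissible_fields_def by blast
  have "c i a = 0" for i a
  proof (rule admissible_eq_0[OF c])
    fix i :: 'n and s :: real and b :: "'n \<Rightarrow> nat"
    assume s: "s \<in> {-1, 1}" and b: "\<And>j. j \<noteq> i \<Longrightarrow> b j \<le> k"
    have "s * (\<Sum>a\<in>exponents k i. c i a * (s ^ a i * (\<Prod>j\<in>- {i}. moment (a j + b j)))) = 0"
      using flux[OF s facet_monomial_in_facet_Q[of i b k, OF b]] unfolding vc I[OF s] .
    then show "(\<Sum>a\<in>exponents k i. c i a * (s ^ a i * (\<Prod>j\<in>- {i}. moment (a j + b j)))) = 0"
      using s by auto
  next
    fix i :: 'n and b :: "'n \<Rightarrow> nat"
    assume b: "b i + 2 \<le> k" "\<And>j. j \<noteq> i \<Longrightarrow> b j \<le> k"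
    have "integral ref_element (\<lambda>x. v x \<bullet> axis i (monomial b x)) = 0"
      by (rule interior[OF _ T[of b i, OF b]]) (use b(1) in linarith)
    then show "(\<Sum>a\<in>exponents k i. c i a * (\<Prod>j\<in>UNIV. moment (a j + b j))) = 0"
      unfolding vc integral_field_axis_monomial .
  qed
  then show ?thesis
    by (simp add: vc poly_field_def fun_eq_iff vec_eq_iff)
qed

theorem theorem2p2:
  fixes k :: nat
  assumes "k \<ge> 1"
  shows
    "(\<forall>v \<in> enhanced_RT2 k.
        (\<forall>i. \<forall>s \<in> {-1, 1}. \<forall>p \<in> facet_Q i k.
            edge_integral i s (\<lambda>x. v x \<bullet> outward_normal i s * p x) = 0) \<longrightarrow>
        (k \<ge> 2 \<longrightarrow> (\<forall>p \<in> interior_test2 k. integral ref_element (\<lambda>x. v x \<bullet> p x) = 0)) \<longrightarrow>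
        v = 0) \<and>
     (\<forall>v \<in> enhanced_RT3 k.
        (\<forall>i. \<forall>s \<in> {-1, 1}. \<forall>p \<in> facet_Q i k.
            face_integral i s (\<lambda>x. v x \<bullet> outward_normal i s * p x) = 0) \<longrightarrow>
        (k \<ge> 2 \<longrightarrow> (\<forall>p \<in> interior_test3 k. integral ref_element (\<lambda>x. v x \<bullet> p x) = 0)) \<longrightarrow>
        v = 0)"
proof (intro conjI ballI impI)
  fix v :: "real ^ 2 \<Rightarrow> real ^ 2"
  assume v: "v \<in> enhanced_RT2 k"
    and flux: "\<forall>i. \<forall>s \<in> {-1, 1}. \<forall>p \<in> facet_Q i k.
      edge_integral i s (\<lambda>x. v x \<bullet> outward_normal i s * p x) = 0"
    and interior: "k \<ge> 2 \<longrightarrow> (\<forall>p \<in> interior_test2 k. integral ref_element (\<lambda>x. v x \<bullet> p x) = 0)"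
  have "v \<in> admissible_fields k"
    using v enhanced_RT2_subset_admissible_fields[OF assms] by blast
  then show "v = 0"
  proof (rule admissible_field_eq_0[where I = edge_integral and T = "interior_test2 k"])
  qed (use flux interior in \<open>auto simp: edge_integral_field_flux axis_monomial_in_interior_test2\<close>)
next
  fix v :: "real ^ 3 \<Rightarrow> real ^ 3"
  assume v: "v \<in> enhanced_RT3 k"
    and flux: "\<forall>i. \<forall>s \<in> {-1, 1}. \<forall>p \<in> facet_Q i k.
      face_integral i s (\<lambda>x. v x \<bullet> outward_normal i s * p x) = 0"
    and interior: "k \<ge> 2 \<longrightarrow> (\<forall>p \<in> interior_test3 k. integral ref_element (\<lambda>x. v x \<bullet> p x) = 0)"
  have "v \<in> admissible_fields k"
    using v enhanced_RT3_subset_admissible_fields[OF assms] by blast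
  then show "v = 0"
  proof (rule admissible_field_eq_0[where I = face_integral and T = "interior_test3 k"])
  qed (use flux interior in \<open>auto simp: face_integral_field_flux axis_monomial_in_interior_test3\<close>)
qed

end
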